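(* For every integer $n\ge 0$, the Lucas-Fubini number $\mathcal{L}_n$ is given by $$\mathcal{L}_n = \sum_{k=0}^{n}\sum_{j=0}^{k}(-1)^{k-j}\binom{k}{j}\frac{\alpha^{k+1}+\beta^{k+1}}{k!}\, j^n .$$
   Context: $\alpha=(1+\sqrt5)/2$ and $\beta=(1-\sqrt5)/2$. Convention: $0^0=1$. ${n\brace k}$ denotes the Stirling number of the second kind (the number of partitions of an $n$-element set into exactly $k$ non-empty blocks). $L_m$ denotes the Lucas numbers: $L_0=2$, $L_1=1$, $L_m=L_{m-1}+L_{m-2}$ for $m\ge2$. The Lucas-Fubini numbers are defined by $\mathcal{L}_n=\sum_{k=0}^n L_{k+1}{n\brace k}$ for $n\ge0$. *)

theory Defs
  imports Complex_Main "HOL-Combinatorics.Stirling" "HOL-Library.Disjoint_Sets"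
begin

definition \<alpha> :: real where "\<alpha> = (1 + sqrt 5) / 2"

definition \<beta> :: real where "\<beta> = (1 - sqrt 5) / 2"

fun lucas :: "nat \<Rightarrow> nat" where
  "lucas 0 = 2"
| "lucas (Suc 0) = 1"
| "lucas (Suc (Suc m)) = lucas (Suc m) + lucas m"

definition lucas_fubini :: "nat \<Rightarrow> nat" where
  "lucas_fubini n = (\<Sum>k=0..n. lucas (k + 1) * Stirling n k)"

text \<open>The library introduces the Stirling numbers of the second kind by their recurrence.
  The lemma \<open>Stirling_eq_card_partitions\<close> below confirms that they count the partitions of
  a finite set into a given number of non-empty blocks.\<close>

lemma card_partitions_insert:
  assumes fin: "finite A" and x: "x \<notin> A"
  shows "card {Q. partition_on (insert x A) Q \<and> card Q = Suc k} =
    Suc k * card {P. partition_on A P \<and> card P = Suc k} + card {P. partition_on A P \<and> card P = k}"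
proof -
  define PP where "PP = (\<lambda>B k. {P. partition_on B P \<and> card P = k} :: 'a set set set)"
  define N where "N = {Q \<in> PP (insert x A) (Suc k). {x} \<notin> Q}"
  define S where "S = {Q \<in> PP (insert x A) (Suc k). {x} \<in> Q}"
  have finP: "finite P" if "partition_on B P" "finite B" for B :: "'a set" and P
    using that finite_elements by blast
  have finPP: "finite (PP B k)" if "finite B" for B k
    by (rule finite_subset[of _ "Pow (Pow B)"])
      (use that in \<open>auto simp: PP_def partition_on_def\<close>)
  have split: "card (PP (insert x A) (Suc k)) = card N + card S"
  proof -
    have "PP (insert x A) (Suc k) = N \<union> S" "N \<inter> S = {}"
      by (auto simp: N_def S_def)
    moreover have "finite N" "finite S"
      using finPP[of "insert x A" "Suc k"] fin by (auto simp: N_def S_def)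
    ultimately show ?thesis by (simp add: card_Un_disjoint)
  qed
  have cardS: "card S = card (PP A k)"
  proof -
    have "bij_betw (insert {x}) (PP A k) S"
    proof (rule bij_betw_byWitness[where f' = "\<lambda>Q. Q - {{x}}"])
      have nin: "{x} \<notin> P" if "partition_on A P" for P
        using that x by (auto simp: partition_on_def)
      show "\<forall>P\<in>PP A k. insert {x} P - {{x}} = P"
        using nin by (auto simp: PP_def)
      show "\<forall>Q\<in>S. insert {x} (Q - {{x}}) = Q"
        by (auto simp: S_def)
      show "insert {x} ` PP A k \<subseteq> S"
      proof (rule image_subsetI)
        fix P assume P: "P \<in> PP A k"
        then have p: "partition_on A P" and c: "card P = k" by (auto simp: PP_def)
        have "partition_on (insert x A) (insert {x} P)"
          using p x by (auto simp: partition_on_def disjoint_def)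
        moreover have "card (insert {x} P) = Suc k"
          using nin[OF p] finP[OF p fin] c by simp
        ultimately show "insert {x} P \<in> S" by (simp add: S_def PP_def)
      qed
      show "(\<lambda>Q. Q - {{x}}) ` S \<subseteq> PP A k"
      proof (rule image_subsetI)
        fix Q assume Q: "Q \<in> S"
        then have p: "partition_on (insert x A) Q" and c: "card Q = Suc k" and xi: "{x} \<in> Q"
          by (auto simp: S_def PP_def)
        have dis: "C \<inter> D = {}" if "C \<in> Q" "D \<in> Q" "C \<noteq> D" for C D
          using p that by (auto simp: partition_on_def disjoint_def)
        have un: "\<Union>Q = insert x A" using p by (simp add: partition_on_def)
        have "\<Union>(Q - {{x}}) = A"
        proof
          show "\<Union>(Q - {{x}}) \<subseteq> A"
            using dis[OF xi] un by blast
          show "A \<subseteq> \<Union>(Q - {{x}})"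
            using un x by blast
        qed
        then have "partition_on A (Q - {{x}})"
          using p by (auto simp: partition_on_def disjoint_def)
        moreover have "card (Q - {{x}}) = k"
          using c xi by simp
        ultimately show "Q - {{x}} \<in> PP A k" by (simp add: PP_def)
      qed
    qed
    then show ?thesis by (simp add: bij_betw_same_card)
  qed
  have cardN: "card N = Suc k * card (PP A (Suc k))"
  proof -
    define f where "f = (\<lambda>(P, B). insert (insert x B) (P - {B}))"
    define g where "g = (\<lambda>Q. let B = \<Union>{C \<in> Q. x \<in> C} - {x} in (insert B {C \<in> Q. x \<notin> C}, B))"
    have gQ: "\<exists>C. C \<in> Q \<and> x \<in> C \<and> g Q = (insert (C - {x}) (Q - {C}), C - {x}) \<and> (\<forall>D\<in>Q. D \<noteq> C \<longrightarrow> x \<notin> D)"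
      if p: "partition_on (insert x A) Q" for Q
    proof -
      have "x \<in> \<Union>Q" using p by (simp add: partition_on_def)
      then obtain C where C: "C \<in> Q" "x \<in> C" by blast
      have u: "x \<notin> D" if "D \<in> Q" "D \<noteq> C" for D
        using p C that by (auto simp: partition_on_def disjoint_def)
      have "{D \<in> Q. x \<in> D} = {C}" "{D \<in> Q. x \<notin> D} = Q - {C}"
        using C u by auto
      then have "g Q = (insert (C - {x}) (Q - {C}), C - {x})"
        by (simp add: g_def Let_def)
      with C u show ?thesis by blast
    qed
    have "bij_betw f (SIGMA P:PP A (Suc k). P) N"
    proof (rule bij_betw_byWitness[where f' = g])
      show "\<forall>z\<in>(SIGMA P:PP A (Suc k). P). g (f z) = z"
      proof safe
        fix P B assume P: "P \<in> PP A (Suc k)" and B: "B \<in> P"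
        then have xn: "x \<notin> C" if "C \<in> P" for C
          using that x by (auto simp: PP_def partition_on_def)
        have e: "{C \<in> f (P, B). x \<in> C} = {insert x B}" "{C \<in> f (P, B). x \<notin> C} = P - {B}"
          using xn B by (auto simp: f_def)
        have "insert x B - {x} = B" using xn[OF B] by auto
        then show "g (f (P, B)) = (P, B)"
          using B by (simp add: g_def e insert_absorb)
      qed
      show "\<forall>Q\<in>N. f (g Q) = Q"
      proof
        fix Q assume "Q \<in> N"
        then have p: "partition_on (insert x A) Q" and ns: "{x} \<notin> Q" by (auto simp: N_def PP_def)
        from gQ[OF p] obtain C where C: "C \<in> Q" "x \<in> C"
          and g: "g Q = (insert (C - {x}) (Q - {C}), C - {x})" by blast
        have "C - {x} \<noteq> {}"
        proof
          assume "C - {x} = {}"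
          then have "C = {x}" using C(2) by blast
          then show False using C(1) ns by simp
        qed
        then obtain y where y: "y \<in> C" "y \<noteq> x" by auto
        have "C - {x} \<notin> Q"
        proof
          assume "C - {x} \<in> Q"
          moreover have "C \<noteq> C - {x}" using C by blast
          moreover have "disjoint Q" using p by (simp add: partition_on_def)
          ultimately have "C \<inter> (C - {x}) = {}"
            using C(1) by (auto dest: disjointD)
          then show False using y by blast
        qed
        then have "insert (C - {x}) (Q - {C}) - {C - {x}} = Q - {C}" by blast
        moreover have "insert x (C - {x}) = C" using C(2) by blast
        moreover have "insert C (Q - {C}) = Q" using C(1) by blast
        ultimately show "f (g Q) = Q"
          by (simp only: f_def g prod.case)
      qed
      show "f ` (SIGMA P:PP A (Suc k). P) \<subseteq> N"
      proof (rule image_subsetI)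
        fix z assume "z \<in> (SIGMA P:PP A (Suc k). P)"
        then obtain P B where z: "z = (P, B)" and p: "partition_on A P"
          and c: "card P = Suc k" and B: "B \<in> P" by (auto simp: PP_def)
        have xn: "x \<notin> C" if "C \<in> P" for C
          using that x p by (auto simp: partition_on_def)
        have dis: "C \<inter> D = {}" if "C \<in> P" "D \<in> P" "C \<noteq> D" for C D
          using p that by (auto simp: partition_on_def disjoint_def)
        have ne: "B \<noteq> {}" using p B by (auto simp: partition_on_def)
        have un: "\<Union>(f (P, B)) = insert x A"
          using p B by (auto simp: f_def partition_on_def)
        have "disjoint (f (P, B))"
          unfolding disjoint_def f_def using dis B xn by auto
        with un have "partition_on (insert x A) (f (P, B))"
          using p by (auto simp: partition_on_def f_def)
        moreover have "card (f (P, B)) = Suc k"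
        proof -
          have "insert x B \<notin> P - {B}" using xn by auto
          then show ?thesis using finP[OF p fin] c B by (simp add: f_def)
        qed
        moreover have "{x} \<notin> f (P, B)"
          using xn ne B by (auto simp: f_def)
        ultimately show "f z \<in> N" by (simp add: z N_def PP_def)
      qed
      show "g ` N \<subseteq> (SIGMA P:PP A (Suc k). P)"
      proof (rule image_subsetI)
        fix Q assume "Q \<in> N"
        then have p: "partition_on (insert x A) Q" and ns: "{x} \<notin> Q"
          and c: "card Q = Suc k" by (auto simp: N_def PP_def)
        from gQ[OF p] obtain C where C: "C \<in> Q" "x \<in> C"
          and g: "g Q = (insert (C - {x}) (Q - {C}), C - {x})"
          and u: "\<And>D. D \<in> Q \<Longrightarrow> D \<noteq> C \<Longrightarrow> x \<notin> D" by blast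
        have dis: "D \<inter> E = {}" if "D \<in> Q" "E \<in> Q" "D \<noteq> E" for D E
          using p that by (auto simp: partition_on_def disjoint_def)
        have un: "\<Union>Q = insert x A" using p by (simp add: partition_on_def)
        have ne: "C - {x} \<noteq> {}"
        proof
          assume "C - {x} = {}"
          then have "C = {x}" using C(2) by blast
          then show False using C(1) ns by simp
        qed
        let ?P = "insert (C - {x}) (Q - {C})"
        have "\<Union>?P = A"
        proof -
          have "\<Union>Q = C \<union> \<Union>(Q - {C})" using C(1) by auto
          moreover have "x \<notin> \<Union>(Q - {C})" using u by auto
          ultimately have "\<Union>?P = \<Union>Q - {x}" by auto
          then show ?thesis using un x by simp
        qed
        moreover have "disjoint ?P"
        proof (rule disjointI)
          fix D E assume DE: "D \<in> ?P" "E \<in> ?P" "D \<noteq> E"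
          have CD: "C \<inter> D = {}" if "D \<in> Q - {C}" for D
            using dis[OF C(1), of D] that by blast
          consider "D \<in> Q - {C}" "E \<in> Q - {C}" | "D = C - {x}" "E \<in> Q - {C}"
            | "D \<in> Q - {C}" "E = C - {x}"
            using DE by auto
          then show "D \<inter> E = {}"
          proof cases
            case 1
            then show ?thesis using dis[of D E] DE(3) by simp
          next
            case 2
            then show ?thesis using CD[of E] by auto
          next
            case 3
            then show ?thesis using CD[of D] by auto
          qed
        qed
        ultimately have "partition_on A ?P"
          using p ne by (auto simp: partition_on_def)
        moreover have "card ?P = Suc k"
        proof -
          have "C - {x} \<notin> Q - {C}"
          proof
            assume "C - {x} \<in> Q - {C}"
            then have "C \<inter> (C - {x}) = {}" using dis[of C "C - {x}"] C by blast
            then show False using ne by blast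
          qed
          moreover have "finite Q" using c card.infinite by force
          ultimately show ?thesis using c C by simp
        qed
        ultimately show "g Q \<in> (SIGMA P:PP A (Suc k). P)" by (simp add: g PP_def)
      qed
    qed
    then have "card N = card (SIGMA P:PP A (Suc k). P)"
      by (simp add: bij_betw_same_card)
    also have "\<dots> = (\<Sum>P\<in>PP A (Suc k). card P)"
      using finP finPP[OF fin] fin by (intro card_SigmaI) (auto simp: PP_def)
    also have "\<dots> = Suc k * card (PP A (Suc k))"
      by (simp add: PP_def)
    finally show ?thesis .
  qed
  from split cardS cardN show ?thesis by (simp add: PP_def)
qed

lemma Stirling_eq_card_partitions:
  assumes "finite A"
  shows "Stirling (card A) k = card {P. partition_on A P \<and> card P = k}"
  using assms
proof (induction A arbitrary: k rule: finite_induct)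
  case empty
  have "{P. partition_on ({} :: 'a set) P \<and> card P = k} = (if k = 0 then {{}} else {})"
    by (auto simp: partition_on_empty)
  then show ?case by (cases k) (simp_all only: card.empty Stirling.simps, simp_all)
next
  case (insert x A)
  show ?case
  proof (cases k)
    case 0
    have "card P \<noteq> 0" if p: "partition_on (insert x A) P" for P
    proof -
      have "finite P" using finite_elements[OF _ p] insert.hyps by simp
      moreover have "P \<noteq> {}" using p by (auto simp: partition_on_def)
      ultimately show ?thesis by simp
    qed
    then have "{P. partition_on (insert x A) P \<and> card P = k} = {}" using 0 by auto
    then have "card {P. partition_on (insert x A) P \<and> card P = k} = 0"
      by (simp only: card.empty)
    moreover have "Stirling (card (insert x A)) k = 0" using 0 insert.hyps by simp
    ultimately show ?thesis by simp
  next
    case (Suc m)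
    then show ?thesis
      using insert by (simp add: card_partitions_insert)
  qed
qed

end

theory Submission
  imports Defs
begin

text \<open>By Binet's formula \<open>L\<^sub>m = \<alpha>\<^sup>m + \<beta>\<^sup>m\<close>, so it suffices to expand the Stirling numbers explicitly.
  The alternating sum \<open>T n k = \<Sum>j\<le>k. (-1)\<^sup>k\<^sup>-\<^sup>j (k choose j) j\<^sup>n\<close> equals \<open>k!\<close> times the Stirling number,
  because \<open>j (k+1 choose j) = (k+1) ((k+1 choose j) - (k choose j))\<close> gives
  \<open>T (n+1) (k+1) = (k+1) (T n (k+1) + T n k)\<close>.\<close>

text \<open>Both \<alpha> and \<beta> are roots of \<open>x^2 = x + 1\<close>, so their powers obey
  the Lucas recurrence.\<close>

lemma lucas_Binet: "real (lucas m) = \<alpha> ^ m + \<beta> ^ m"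
proof (induction m rule: lucas.induct)
  case (3 m)
  have "\<alpha>\<^sup>2 = \<alpha> + 1" "\<beta>\<^sup>2 = \<beta> + 1"
    by (simp_all add: \<alpha>_def \<beta>_def power2_eq_square field_simps)
  then have "\<alpha> ^ Suc (Suc m) = \<alpha> ^ Suc m + \<alpha> ^ m" "\<beta> ^ Suc (Suc m) = \<beta> ^ Suc m + \<beta> ^ m"
    by (simp_all add: power2_eq_square algebra_simps flip: mult.assoc)
  with 3 show ?case by simp
qed (simp_all add: \<alpha>_def \<beta>_def field_simps)

text \<open>Absorption turns the left side into \<open>Suc k\<close> times
  \<open>k choose (j - 1)\<close>, which Pascal's rule writes as a difference; hence a ring instead
  of \<open>nat\<close>.\<close>

lemma of_nat_mult_binomial_Suc:
  "of_nat j * of_nat (Suc k choose j) =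
    (of_nat (Suc k) * (of_nat (Suc k choose j) - of_nat (k choose j)) :: 'a::comm_ring_1)"
proof (cases j)
  case (Suc i)
  have "Suc i * (Suc k choose Suc i) = Suc k * (k choose i)"
    by (rule Suc_times_binomial_eq[symmetric, simplified mult.commute])
  then have "of_nat (Suc i) * of_nat (Suc k choose Suc i) = (of_nat (Suc k) * of_nat (k choose i) :: 'a)"
    by (metis of_nat_mult)
  then show ?thesis by (simp add: Suc)
qed simp

lemma fact_mult_Stirling:
  "fact k * of_nat (Stirling n k) =
    (\<Sum>j\<le>k. (-1) ^ (k - j) * of_nat (k choose j) * of_nat j ^ n :: 'a::{comm_ring_1,ring_char_0})"
proof (induction n arbitrary: k)
  case 0
  \<comment> \<open>Since \<open>j ^ 0 = 1\<close> even at \<open>j = 0\<close>, the sum is the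
    binomial expansion of \<open>(1 - 1) ^ k\<close>, which is 1 for \<open>k = 0\<close> and 0
    otherwise.\<close>
  have "(\<Sum>j\<le>k. (-1) ^ (k - j) * of_nat (k choose j)) = ((1 + (-1)) ^ k :: 'a)"
    by (subst binomial_ring) (simp add: mult.commute)
  then show ?case by (cases k) simp_all
next
  case (Suc n)
  show ?case
  proof (cases k)
    case 0
    then show ?thesis by simp
  next
    case (Suc m)
    have "(\<Sum>j\<le>Suc m. (-1) ^ (Suc m - j) * of_nat (Suc m choose j) * of_nat j ^ Suc n)
      = (\<Sum>j\<le>Suc m. of_nat (Suc m) * ((-1) ^ (Suc m - j) * of_nat (Suc m choose j) * of_nat j ^ n)
        - of_nat (Suc m) * ((-1) ^ (Suc m - j) * of_nat (m choose j) * of_nat j ^ n) :: 'a)"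
    proof (rule sum.cong[OF refl])
      fix j
      have "(-1) ^ (Suc m - j) * of_nat (Suc m choose j) * of_nat j ^ Suc n
        = (-1) ^ (Suc m - j) * of_nat j ^ n * (of_nat j * of_nat (Suc m choose j) :: 'a)"
        by (simp only: power_Suc mult_ac)
      then show "(-1) ^ (Suc m - j) * of_nat (Suc m choose j) * of_nat j ^ Suc n
        = of_nat (Suc m) * ((-1) ^ (Suc m - j) * of_nat (Suc m choose j) * of_nat j ^ n)
        - (of_nat (Suc m) * ((-1) ^ (Suc m - j) * of_nat (m choose j) * of_nat j ^ n) :: 'a)"
        unfolding of_nat_mult_binomial_Suc by (simp only: right_diff_distrib mult_ac)
    qed
    also have "\<dots> = of_nat (Suc m) * (fact (Suc m) * of_nat (Stirling n (Suc m)))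
      - of_nat (Suc m) * (\<Sum>j\<le>Suc m. (-1) ^ (Suc m - j) * of_nat (m choose j) * of_nat j ^ n)"
      by (simp only: sum_subtractf sum_distrib_left Suc.IH)
    \<comment> \<open>The term \<open>j = Suc m\<close> vanishes because
      \<open>m choose Suc m = 0\<close>; in the others the exponent exceeds \<open>m - j\<close> by
      one, which flips the sign.\<close>
    also have "(\<Sum>j\<le>Suc m. (-1) ^ (Suc m - j) * of_nat (m choose j) * of_nat j ^ n)
      = (- (fact m * of_nat (Stirling n m)) :: 'a)"
      by (simp add: Suc.IH Suc_diff_le sum_negf binomial_eq_0)
    finally show ?thesis
      by (simp add: \<open>k = Suc m\<close> algebra_simps)
  qed
qed

theorem theorem2:
  fixes n :: nat
  shows "real (lucas_fubini n) =
    (\<Sum>k=0..n. \<Sum>j=0..k.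
      (-1) ^ (k - j) * real (k choose j) * ((\<alpha> ^ (k + 1) + \<beta> ^ (k + 1)) / fact k) * real j ^ n)"
proof -
  have "real (lucas (k + 1) * Stirling n k) = (\<Sum>j=0..k.
      (-1) ^ (k - j) * real (k choose j) * ((\<alpha> ^ (k + 1) + \<beta> ^ (k + 1)) / fact k) * real j ^ n)" for k
  proof -
    \<comment> \<open>Inserting \<open>fact k / fact k\<close> prepares for
      \<open>fact_mult_Stirling\<close>.\<close>
    have "real (lucas (k + 1) * Stirling n k) =
      (\<alpha> ^ (k + 1) + \<beta> ^ (k + 1)) / fact k * (fact k * real (Stirling n k))"
      by (simp only: of_nat_mult lucas_Binet) simp
    also have "\<dots> = (\<Sum>j=0..k.
      (-1) ^ (k - j) * real (k choose j) * ((\<alpha> ^ (k + 1) + \<beta> ^ (k + 1)) / fact k) * real j ^ n)"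
      by (simp only: fact_mult_Stirling sum_distrib_left atLeast0AtMost mult_ac)
    finally show ?thesis .
  qed
  then show ?thesis
    by (simp only: lucas_fubini_def of_nat_sum)
qed

end
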